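(* Let $\alpha>0$ and let $I=[a,b]$ with $0\le a<b<1$. There exist an integer $k\ge 1$ and a real number $0<\delta<1$ such that for every $0<\epsilon<\delta$ and every polynomial $p\in\bigcup_{n\ge 0}\mathcal{F}_\alpha^{(n)}$, $$\operatorname{Leb}\{x\in I: |p(x)|<\epsilon\}\le C\,\epsilon^{1/k},$$ where $$C:=\frac{2^{3k+5}(1+\alpha)^{2k}\deg(p)^{2(k+1)}}{\delta^2\,(1-r_\alpha(k))}.$$
   Context: For $\alpha>0$ let $\mathcal{F}_\alpha=\{p(x)=1+\sum_{n=1}^\infty a_nx^n : a_n\in[-\alpha,\alpha]\}$ (real power series, convergent for $|x|<1$), and let $\mathcal{F}_\alpha^{(n)}\subset\mathcal{F}_\alpha$ be the set of those elements that are polynomials of degree $n$. For each integer $k\ge 0$ define $$r_\alpha(k):=\inf\{x\in(0,1) : \exists\, p\in\mathcal{F}_\alpha \text{ with } p^{(j)}(x)=0 \text{ for } j=0,\dots,k\}.$$ It is known that $r_\alpha(k)<1$ for every $k$. $\operatorname{Leb}$ is Lebesgue measure on $\mathbb{R}$. *)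

theory Defs
  imports "HOL-Analysis.Analysis" "HOL-Computational_Algebra.Computational_Algebra"
begin

definition F_series :: "real \<Rightarrow> real fps set" where
  "F_series \<alpha> = {p. fps_nth p 0 = 1 \<and> (\<forall>n\<ge>1. fps_nth p n \<in> {-\<alpha>..\<alpha>})}"

definition F_poly :: "real \<Rightarrow> nat \<Rightarrow> real poly set" where
  "F_poly \<alpha> n = {p. fps_of_poly p \<in> F_series \<alpha> \<and> degree p = n}"

text \<open>The set below is nonempty for every \<open>\<alpha> > 0\<close> and is bounded below by 0, so the infimum is a
  genuine one.  Every series in \<open>F_series \<alpha>\<close> converges on \<open>(-1,1)\<close>; hence the iterated derivative
  at a point of \<open>(0,1)\<close> does not see the values of \<^const>\<open>eval_fps\<close> where the series diverges.\<close>

definition r_inf :: "real \<Rightarrow> nat \<Rightarrow> real" where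
  "r_inf \<alpha> k = Inf {x \<in> {0<..<1}.
     \<exists>p\<in>F_series \<alpha>. \<forall>j\<le>k. (deriv ^^ j) (eval_fps p) x = 0}"

end

theory Submission imports Defs begin

text \<open>The Taylor coefficients at \<open>x\<close> of a series in \<^const>\<open>F_series\<close> are bounded
  uniformly for \<open>x \<in> [0, b]\<close>.  Since such a series equals 1 at 0, its derivatives of order at
  most \<open>k\<close> cannot all be small at one point, for some \<open>k\<close> depending only on \<open>\<alpha>\<close> and \<open>b\<close>.
  Hence \<open>[a, b]\<close> splits into boundedly many intervals on each of which one of these derivatives is
  bounded away from 0, and there the sublevel set has measure \<open>O(\<epsilon> powr (1/k))\<close>.  The constant does not
  depend on \<open>p\<close>, so it is absorbed by shrinking \<open>\<delta>\<close>, given \<open>0 \<le> r_inf \<alpha> k < 1\<close>.\<close>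

section \<open>Multiple zeros of polynomials and bounds on \<open>r_inf\<close>\<close>

lemma higher_deriv_poly:
  fixes p :: "real poly"
  shows "(deriv ^^ j) (poly p) = poly ((pderiv ^^ j) p)"
proof (induction j)
  case (Suc j)
  show ?case
    by (simp add: Suc) (auto simp: fun_eq_iff intro!: DERIV_imp_deriv poly_DERIV)
qed simp

lemma linear_power_dvd_pderiv:
  fixes q :: "'a::idom poly"
  assumes "[:-r, 1:] ^ Suc k dvd q"
  shows "[:-r, 1:] ^ k dvd pderiv q"
proof -
  obtain s where s: "q = [:-r, 1:] ^ Suc k * s"
    using assms by (elim dvdE)
  show ?thesis
    unfolding s pderiv_mult pderiv_power_Suc
    by (intro dvd_add [OF dvd_mult2 dvd_mult] dvd_mult2 dvd_smult le_imp_power_dvd) auto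
qed

lemma poly_higher_pderiv_eq_0:
  fixes q :: "'a::idom poly"
  assumes "[:-r, 1:] ^ Suc k dvd q" "j \<le> k"
  shows "poly ((pderiv ^^ j) q) r = 0"
  using assms
proof (induction j arbitrary: q k)
  case 0
  then have "[:-r, 1:] dvd q"
    by (metis dvd_mult_left power_Suc)
  then show ?case by (simp add: poly_eq_0_iff_dvd)
next
  case (Suc j)
  then obtain k' where k': "k = Suc k'" by (cases k) auto
  then have "[:-r, 1:] ^ Suc k' dvd pderiv q"
    using Suc.prems linear_power_dvd_pderiv by blast
  then show ?case using Suc k' by (simp del: funpow.simps add: funpow_Suc_right)
qed

text \<open>The condition \<open>m * i = n\<close> stays inside the sum so that a further sum over
  \<open>m\<close> can be swapped with it and then counts the \<open>m\<close> that hit a given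
  degree.\<close>

lemma coeff_one_minus_monom_power:
  fixes c :: real
  shows "coeff ((1 - monom c m) ^ K) n =
    (\<Sum>i\<le>K. real (K choose i) * (if m * i = n then (-c) ^ i else 0))"
proof -
  have "(1 - monom c m) ^ K = (monom (-c) m + 1) ^ K"
    by (simp add: minus_monom [symmetric])
  also have "\<dots> = (\<Sum>i\<le>K. of_nat (K choose i) * monom ((-c) ^ i) (m * i))"
    by (simp add: binomial_ring monom_power mult.commute)
  finally show ?thesis
    by (simp add: coeff_sum of_nat_mult_conv_smult)
qed

text \<open>Averaging \<open>(1 - (x/r)\<^sup>m)\<^sup>K\<close> over many \<open>m\<close> keeps the zero at \<open>r\<close> while each nonconstant
  coefficient collects at most one \<open>m\<close> per binomial index, hence becomes small.\<close>

lemma ex_F_series_multiple_zero: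
  assumes "\<alpha> > 0"
  shows "\<exists>x\<in>{0<..<1}. \<exists>p\<in>F_series \<alpha>. \<forall>j\<le>k. (deriv ^^ j) (eval_fps p) x = 0"
proof -
  define K where "K = Suc k"
  \<comment> \<open>The unaveraged coefficients will be bounded by \<open>(2 + 1) ^ K\<close>, so
    averaging over \<open>N\<close> terms brings them below \<alpha>.\<close>
  obtain N0 :: nat where N0: "3 ^ K / \<alpha> < real N0" using reals_Archimedean2 by blast
  define N where "N = Suc N0"
  have N: "3 ^ K / \<alpha> < real N" "N \<ge> 1" using N0 by (auto simp: N_def)
  \<comment> \<open>This choice keeps \<open>(1/r) ^ m\<close> at most 2 for all
    \<open>m \<le> N\<close>, while \<open>r < 1\<close>.\<close>
  define r where "r = root N (1/2)"
  have r: "0 < r" "r < 1" "r ^ N = 1/2"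
    using N by (auto simp: r_def)
  define q where "q = smult (1 / real N) (\<Sum>m\<in>{1..N}. (1 - monom ((1/r) ^ m) m) ^ K)"
  have dvd: "[:-r, 1:] ^ K dvd q"
  proof -
    have "[:-r, 1:] dvd 1 - monom ((1/r) ^ m) m" for m
      using r by (simp add: poly_eq_0_iff_dvd [symmetric] poly_monom power_one_over)
    then show ?thesis
      unfolding q_def by (intro dvd_smult dvd_sum dvd_power_same)
  qed
  have c: "(1/r) ^ m \<le> 2" if "m \<in> {1..N}" for m
  proof -
    have "(1/r) ^ m \<le> (1/r) ^ N" using that r by (intro power_increasing) auto
    then show ?thesis using r by (simp add: power_one_over)
  qed
  have coeff_bound: "\<bar>coeff q n\<bar> \<le> \<alpha>" if n: "n \<ge> 1" for n
  proof -
    have "\<bar>\<Sum>m\<in>{1..N}. coeff ((1 - monom ((1/r) ^ m) m) ^ K) n\<bar>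
      \<le> (\<Sum>m\<in>{1..N}. \<Sum>i\<le>K. real (K choose i) * (if m * i = n then 2 ^ i else 0))"
    proof (rule order_trans [OF sum_abs], rule sum_mono)
      fix m assume m: "m \<in> {1..N}"
      have "\<bar>(- ((1/r) ^ m)) ^ i\<bar> \<le> 2 ^ i" for i
        using c[OF m] r by (simp add: power_abs) (intro power_mono, auto)
      then show "\<bar>coeff ((1 - monom ((1/r) ^ m) m) ^ K) n\<bar>
          \<le> (\<Sum>i\<le>K. real (K choose i) * (if m * i = n then 2 ^ i else 0))"
        unfolding coeff_one_minus_monom_power
        by (intro order_trans [OF sum_abs] sum_mono) (auto simp: abs_mult intro!: mult_left_mono)
    qed
    also have "\<dots> = (\<Sum>i\<le>K. real (K choose i) * 2 ^ i * real (card {m \<in> {1..N}. m * i = n}))"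
      by (subst sum.swap, rule sum.cong [OF refl])
         (simp add: sum_distrib_left [symmetric] sum.inter_filter [symmetric])
    also have "\<dots> \<le> (\<Sum>i\<le>K. real (K choose i) * 2 ^ i * 1)"
    proof (intro sum_mono mult_left_mono)
      fix i
      have "\<exists>m. {m \<in> {1..N}. m * i = n} \<subseteq> {m}"
      proof (cases "i = 0")
        case True
        then show ?thesis using n by auto
      next
        case False
        then have "{m \<in> {1..N}. m * i = n} \<subseteq> {n div i}" by auto
        then show ?thesis by blast
      qed
      then have "card {m \<in> {1..N}. m * i = n} \<le> 1"
        by (metis card_1_singleton_iff card_mono finite.emptyI finite.insertI One_nat_def)
      then show "real (card {m \<in> {1..N}. m * i = n}) \<le> 1" by simp
    qed auto
    also have "\<dots> = (2 + 1) ^ K"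
      by (subst binomial_ring) simp
    finally have "\<bar>coeff q n\<bar> \<le> 3 ^ K / real N"
      using N by (simp add: q_def coeff_sum abs_mult divide_right_mono)
    also have "\<dots> \<le> \<alpha>" using N assms by (simp add: field_simps)
    finally show ?thesis .
  qed
  have "coeff q 0 = 1"
  proof -
    have "coeff ((1 - monom ((1/r) ^ m) m) ^ K) 0 = 1" if "m \<in> {1..N}" for m
      using that by (simp add: coeff_0_power)
    then show ?thesis using N by (simp add: q_def coeff_sum)
  qed
  then have "fps_of_poly q \<in> F_series \<alpha>"
    using coeff_bound by (auto simp: F_series_def abs_le_iff) (smt (verit))
  moreover have "(deriv ^^ j) (eval_fps (fps_of_poly q)) r = 0" if "j \<le> k" for j
  proof -
    have "eval_fps (fps_of_poly q) = poly q" by auto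
    then show ?thesis
      using poly_higher_pderiv_eq_0 dvd that by (simp add: higher_deriv_poly K_def)
  qed
  ultimately show ?thesis using r by (intro bexI[of _ r] bexI[of _ "fps_of_poly q"]) auto
qed

text \<open>Puts the factor \<open>1 - r_inf \<alpha> k\<close> of the final denominator into (0,1];
  the strict bound comes from the multiple zero constructed above.\<close>

lemma r_inf_bounds:
  assumes "\<alpha> > 0"
  shows "0 \<le> r_inf \<alpha> k" "r_inf \<alpha> k < 1"
proof -
  let ?X = "{x \<in> {0<..<1}. \<exists>p\<in>F_series \<alpha>. \<forall>j\<le>k. (deriv ^^ j) (eval_fps p) x = 0}"
  obtain x where x: "x \<in> ?X"
    using ex_F_series_multiple_zero [OF assms, of k] by blast
  show "0 \<le> r_inf \<alpha> k"
    unfolding r_inf_def using x by (intro cInf_greatest) auto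
  have "r_inf \<alpha> k \<le> x"
    unfolding r_inf_def using x by (intro cInf_lower bdd_belowI [where m = 0]) auto
  then show "r_inf \<alpha> k < 1" using x by auto
qed

section \<open>Sublevel sets of a polynomial with one derivative bounded below\<close>

lemma poly_sublevel_measurable:
  fixes p :: "real poly"
  assumes "is_interval S"
  shows "{x \<in> S. \<bar>poly p x\<bar> < e} \<in> sets borel"
proof -
  have "{x. \<bar>poly p x\<bar> < e} \<in> sets borel"
    by (intro borel_open open_Collect_less continuous_intros)
  moreover have "{x \<in> S. \<bar>poly p x\<bar> < e} = S \<inter> {x. \<bar>poly p x\<bar> < e}" by auto
  ultimately show ?thesis using real_interval_borel_measurable [OF assms] by simp
qed

lemma poly_higher_pderiv_mvt:
  fixes p :: "real poly"
  assumes "x < y"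
  obtains z where "x < z" "z < y"
    "poly ((pderiv ^^ j) p) y - poly ((pderiv ^^ j) p) x = (y - x) * poly ((pderiv ^^ Suc j) p) z"
  using poly_MVT [OF assms, of "(pderiv ^^ j) p"] by auto

text \<open>Induction on \<open>j\<close>: as the derivative of order \<open>j\<close> grows at rate at least \<open>lam\<close>, it is smaller
  than \<open>lam * t\<close> only on a set of diameter \<open>2 * t\<close>, and the induction hypothesis applies on the two
  remaining intervals.\<close>

lemma poly_sublevel_measure:
  fixes p :: "real poly"
  assumes "is_interval S" "\<And>x. x \<in> S \<Longrightarrow> lam \<le> poly ((pderiv ^^ j) p) x" "lam > 0" "t > 0"
  shows "emeasure lborel {x \<in> S. \<bar>poly p x\<bar> < lam * t ^ j} \<le> ennreal (4 * (2 ^ j - 1) * t)"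
  using assms
proof (induction j arbitrary: p S lam)
  case 0
  then have "{x \<in> S. \<bar>poly p x\<bar> < lam * t ^ 0} = {}" by fastforce
  then show ?case by (simp only: emeasure_empty) simp
next
  case (Suc j)
  define g where "g = poly ((pderiv ^^ j) p)"
  let ?E = "\<lambda>S. {x \<in> S. \<bar>poly p x\<bar> < lam * t ^ Suc j}"
  define A where "A = {x \<in> S. g x \<le> - (lam * t)}"
  define B where "B = {x \<in> S. lam * t \<le> g x}"
  define M where "M = {x \<in> S. \<bar>g x\<bar> < lam * t}"
  have S: "z \<in> S" if "x \<in> S" "y \<in> S" "x \<le> z" "z \<le> y" for x y z
    using Suc.prems(1) that unfolding is_interval_1 by blast
  have gap: "lam * (y - x) \<le> g y - g x" if "x \<in> S" "y \<in> S" "x \<le> y" for x y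
  proof (cases "x = y")
    case False
    then have "x < y" using that by auto
    then obtain z where z: "x < z" "z < y" "g y - g x = (y - x) * poly ((pderiv ^^ Suc j) p) z"
      unfolding g_def by (rule poly_higher_pderiv_mvt)
    then have "z \<in> S" using S that by (meson less_imp_le)
    then have "lam \<le> poly ((pderiv ^^ Suc j) p) z" by (rule Suc.prems(2))
    then show ?thesis using z \<open>x < y\<close> by (simp add: mult.commute)
  qed auto
  then have mono: "g x \<le> g y" if "x \<in> S" "y \<in> S" "x \<le> y" for x y
    using that \<open>lam > 0\<close> by (smt (verit) mult_nonneg_nonneg)
  \<comment> \<open>Since \<open>g\<close> is monotone on \<open>S\<close>, preimages of
    order-convex sets are intervals, as the induction hypothesis demands of \<open>A\<close> and
    \<open>B\<close>.\<close>
  have ivl: "is_interval {x \<in> S. P (g x)}"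
    if P: "\<And>u v w. P u \<Longrightarrow> P w \<Longrightarrow> u \<le> v \<Longrightarrow> v \<le> w \<Longrightarrow> P v" for P
    unfolding is_interval_1
  proof (intro ballI allI impI)
    fix x y z
    assume "x \<in> {x \<in> S. P (g x)}" "y \<in> {x \<in> S. P (g x)}" "x \<le> z \<and> z \<le> y"
    moreover from this have "z \<in> S" using S by blast
    ultimately show "z \<in> {x \<in> S. P (g x)}"
      using P [of "g x" "g y" "g z"] mono [of x z] mono [of z y] by simp
  qed
  have A: "is_interval A" and B: "is_interval B" and M: "is_interval M"
    unfolding A_def B_def M_def by (rule ivl; linarith)+
  have lt: "lam * t > 0" using Suc.prems by simp
  \<comment> \<open>With \<open>lam * t\<close> in the role of \<open>lam\<close>, the induction
    hypothesis for order \<open>j\<close> speaks about the same sublevel threshold. On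
    \<open>A\<close>, where \<open>g\<close> is negative, it is applied to
    \<open>-p\<close>.\<close>
  have pow: "lam * t * t ^ j = lam * t ^ Suc j" by simp
  have EB: "emeasure lborel (?E B) \<le> ennreal (4 * (2 ^ j - 1) * t)"
    using Suc.IH [OF B, of "lam * t" p] lt \<open>t > 0\<close>
    unfolding pow by (auto simp: B_def g_def)
  have "(pderiv ^^ j) (-p) = - (pderiv ^^ j) p"
    using higher_pderiv_smult [of j "-1" p] by simp
  then have EA: "emeasure lborel (?E A) \<le> ennreal (4 * (2 ^ j - 1) * t)"
    using Suc.IH [OF A, of "lam * t" "-p"] lt \<open>t > 0\<close>
    unfolding pow by (auto simp: A_def g_def)
  have EM: "emeasure lborel M \<le> ennreal (4 * t)"
  proof (cases "M = {}")
    case False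
    then obtain x0 where x0: "x0 \<in> M" by auto
    have "\<bar>x - x0\<bar> \<le> 2 * t" if "x \<in> M" for x
    proof -
      have "lam * \<bar>x - x0\<bar> \<le> lam * (2 * t)"
        using gap [of x x0] gap [of x0 x] that x0
        by (cases "x \<le> x0") (auto simp: M_def abs_less_iff algebra_simps)
      then show ?thesis using \<open>lam > 0\<close> by simp
    qed
    then have "M \<subseteq> {x0 - 2 * t..x0 + 2 * t}" by (fastforce simp: abs_le_iff)
    then have "emeasure lborel M \<le> emeasure lborel {x0 - 2 * t..x0 + 2 * t}"
      by (intro emeasure_mono) auto
    then show ?thesis using \<open>t > 0\<close> by simp
  qed auto
  have sets: "?E A \<in> sets lborel" "?E B \<in> sets lborel" "M \<in> sets lborel"
    using poly_sublevel_measurable A B real_interval_borel_measurable [OF M] by auto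
  have "emeasure lborel (?E S) \<le> emeasure lborel (?E A \<union> ?E B \<union> M)"
    using sets by (intro emeasure_mono) (auto simp: A_def B_def M_def)
  also have "\<dots> \<le> emeasure lborel (?E A) + emeasure lborel (?E B) + emeasure lborel M"
    using sets by (intro order_trans [OF emeasure_subadditive] add_mono order.refl) auto
  also have "\<dots> \<le> ennreal (4 * (2 ^ j - 1) * t) + ennreal (4 * (2 ^ j - 1) * t) + ennreal (4 * t)"
    by (intro add_mono EA EB EM)
  \<comment> \<open>The factor \<open>4 * (2 ^ j - 1)\<close> solves the recurrence c(j+1) = 2 c(j)
    + 4 with c(0) = 0.\<close>
  also have "\<dots> = ennreal (4 * (2 ^ Suc j - 1) * t)"
    using \<open>t > 0\<close> by (simp add: ennreal_plus [symmetric] algebra_simps del: ennreal_plus)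
  finally show ?case .
qed

section \<open>Taylor coefficients as coefficients of shifted polynomials\<close>

lemma pcompose_conv_sum:
  fixes p :: "'a::comm_semiring_1 poly"
  shows "pcompose p q = (\<Sum>n\<le>degree p. smult (coeff p n) (q ^ n))"
  by (simp add: pcompose_altdef poly_altdef degree_map_poly coeff_map_poly)

lemma coeff_pcompose_shift:
  fixes p :: "'a::comm_semiring_1 poly"
  shows "coeff (pcompose p [:x, 1:]) i =
    (\<Sum>n\<le>degree p. coeff p n * (of_nat (n choose i) * x ^ (n - i)))"
proof -
  have "coeff ([:x, 1:] ^ n) i = of_nat (n choose i) * x ^ (n - i)" for n
  proof (cases "i \<le> n")
    case True
    then show ?thesis by (simp add: coeff_linear_poly_power)
  next
    case False
    have "degree ([:x, 1:] ^ n) \<le> n"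
      by (rule order_trans [OF degree_power_le]) simp
    with False show ?thesis by (simp add: coeff_eq_0 binomial_eq_0)
  qed
  then show ?thesis by (simp add: pcompose_conv_sum coeff_sum)
qed

lemma pcompose_shift_shift:
  fixes p :: "'a::comm_semiring_1 poly"
  shows "pcompose (pcompose p [:x, 1:]) [:y, 1:] = pcompose p [:x + y, 1:]"
  by (simp add: pcompose_assoc [symmetric] pcompose_pCons)

lemma higher_pderiv_pcompose_shift:
  fixes p :: "'a::idom poly"
  shows "(pderiv ^^ j) (pcompose p [:x, 1:]) = pcompose ((pderiv ^^ j) p) [:x, 1:]"
  by (induction j) (simp_all add: pderiv_pcompose pderiv_pCons)

lemma poly_higher_pderiv_conv_coeff:
  fixes p :: "'a::{idom, semiring_char_0} poly"
  shows "poly ((pderiv ^^ j) p) x = fact j * coeff (pcompose p [:x, 1:]) j"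
proof -
  have "poly ((pderiv ^^ j) p) x = coeff ((pderiv ^^ j) (pcompose p [:x, 1:])) 0"
    by (simp add: higher_pderiv_pcompose_shift)
  also have "\<dots> = fact j * coeff (pcompose p [:x, 1:]) j"
    by (simp add: coeff_higher_pderiv pochhammer_fact)
  finally show ?thesis .
qed

lemma binomial_term_le:
  fixes x y :: real
  assumes "0 \<le> x" "0 \<le> y"
  shows "real (n choose i) * x ^ (n - i) * y ^ i \<le> (x + y) ^ n"
proof (cases "i \<le> n")
  case True
  have "real (n choose i) * y ^ i * x ^ (n - i) \<le> (\<Sum>k\<le>n. real (n choose k) * y ^ k * x ^ (n - k))"
    using True assms by (intro member_le_sum) auto
  then show ?thesis by (simp add: binomial_ring [of y x] add.commute [of x] mult_ac)
qed (use assms in \<open>auto simp: binomial_eq_0\<close>)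

text \<open>A Cauchy estimate with radius \<rho> about \<open>x\<close>, free of the degree: by
  \<open>binomial_term_le\<close> the coefficient of index \<open>n\<close> contributes at most
  \<open>B * (x + \<rho>) ^ n\<close>, and the geometric series sums these.\<close>

lemma coeff_pcompose_shift_bound:
  fixes p :: "real poly"
  assumes "\<And>n. \<bar>coeff p n\<bar> \<le> B" "0 \<le> x" "0 < \<rho>" "x + \<rho> < 1"
  shows "\<bar>coeff (pcompose p [:x, 1:]) j\<bar> * \<rho> ^ j \<le> B / (1 - (x + \<rho>))"
proof -
  have B: "0 \<le> B" using assms(1) [of 0] by linarith
  have "\<bar>coeff (pcompose p [:x, 1:]) j\<bar> * \<rho> ^ j
      \<le> (\<Sum>n\<le>degree p. \<bar>coeff p n\<bar> * (real (n choose j) * x ^ (n - j))) * \<rho> ^ j"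
    unfolding coeff_pcompose_shift using assms
    by (intro mult_right_mono order_trans [OF sum_abs] sum_mono) (auto simp: abs_mult)
  also have "\<dots> = (\<Sum>n\<le>degree p. \<bar>coeff p n\<bar> * (real (n choose j) * x ^ (n - j) * \<rho> ^ j))"
    by (simp only: sum_distrib_right mult.assoc)
  also have "\<dots> \<le> (\<Sum>n\<le>degree p. B * (x + \<rho>) ^ n)"
    using assms B by (intro sum_mono mult_mono binomial_term_le) auto
  also have "\<dots> = B * (\<Sum>n\<le>degree p. (x + \<rho>) ^ n)"
    by (simp add: sum_distrib_left)
  also have "\<dots> \<le> B * (1 / (1 - (x + \<rho>)))"
  proof (rule mult_left_mono [OF _ B])
    have "(\<lambda>n. (x + \<rho>) ^ n) sums (1 / (1 - (x + \<rho>)))"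
      using assms by (intro geometric_sums) auto
    then show "(\<Sum>n\<le>degree p. (x + \<rho>) ^ n) \<le> 1 / (1 - (x + \<rho>))"
      using sum_le_suminf [of "\<lambda>n. (x + \<rho>) ^ n" "{..degree p}"] assms
      by (auto simp: sums_iff)
  qed
  finally show ?thesis by simp
qed

section \<open>A uniform lower bound for some derivative\<close>

text \<open>Dominated convergence for series (Tannery): the degrees of the \<open>q n\<close> may be
  unbounded, but for shifts of at most \<open>\<rho> / 4\<close> the terms of the re-expansion have
  a geometric majorant independent of \<open>n\<close>.\<close>

lemma tendsto_coeff_pcompose_shift:
  fixes q :: "nat \<Rightarrow> real poly"
  assumes bound: "\<And>n k. \<bar>coeff (q n) k\<bar> * \<rho> ^ k \<le> B" and "\<rho> > 0"
    and h: "\<And>n. \<bar>h n\<bar> \<le> \<rho> / 4"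
    and lim: "\<And>k. (\<lambda>n. coeff (q n) k) \<longlonglongrightarrow> 0"
  shows "(\<lambda>n. coeff (pcompose (q n) [:h n, 1:]) i) \<longlonglongrightarrow> 0"
proof -
  define a where "a k n = coeff (q n) k * (real (k choose i) * h n ^ (k - i))" for k n
  define C where "C = B / (\<rho> / 4) ^ i"
  \<comment> \<open>The auxiliary radius \<open>\<rho> / 4\<close> makes this one term of a binomial
    expansion whose base is at most \<open>\<rho> / 2\<close>; against the decay of
    \<open>coeff (q n) k\<close> this leaves the ratio 1/2.\<close>
  have choose: "real (k choose i) * \<bar>h n\<bar> ^ (k - i) \<le> (\<rho> / 2) ^ k / (\<rho> / 4) ^ i" for k n
  proof -
    have "real (k choose i) * \<bar>h n\<bar> ^ (k - i) * (\<rho> / 4) ^ i \<le> (\<bar>h n\<bar> + \<rho> / 4) ^ k"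
      using \<open>\<rho> > 0\<close> by (intro binomial_term_le) auto
    also have "\<dots> \<le> (\<rho> / 2) ^ k"
      using h [of n] \<open>\<rho> > 0\<close> by (intro power_mono) auto
    finally show ?thesis using \<open>\<rho> > 0\<close> by (simp add: pos_le_divide_eq)
  qed
  have a_le: "norm (a k n) \<le> \<bar>coeff (q n) k\<bar> * ((\<rho> / 2) ^ k / (\<rho> / 4) ^ i)" for k n
    using mult_left_mono [OF choose [of k n], of "\<bar>coeff (q n) k\<bar>"]
    by (simp add: a_def abs_mult power_abs)
  have dom: "norm (a k n) \<le> C * (1 / 2) ^ k" for k n
  proof -
    have "\<bar>coeff (q n) k\<bar> * ((\<rho> / 2) ^ k / (\<rho> / 4) ^ i) =
        \<bar>coeff (q n) k\<bar> * \<rho> ^ k * ((1 / 2) ^ k / (\<rho> / 4) ^ i)"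
      by (simp add: power_divide)
    also have "\<dots> \<le> B * ((1 / 2) ^ k / (\<rho> / 4) ^ i)"
      using bound \<open>\<rho> > 0\<close> by (intro mult_right_mono) auto
    finally show ?thesis using a_le [of k n] by (simp add: C_def)
  qed
  have lim_a: "(\<lambda>n. a k n) \<longlonglongrightarrow> 0" for k
  proof (rule Lim_null_comparison)
    show "\<forall>\<^sub>F n in sequentially. norm (a k n) \<le> \<bar>coeff (q n) k\<bar> * ((\<rho> / 2) ^ k / (\<rho> / 4) ^ i)"
      using a_le by (intro always_eventually) blast
    show "(\<lambda>n. \<bar>coeff (q n) k\<bar> * ((\<rho> / 2) ^ k / (\<rho> / 4) ^ i)) \<longlonglongrightarrow> 0"
      by (intro tendsto_mult_left_zero tendsto_rabs_zero lim)
  qed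
  have "(\<lambda>n. suminf (\<lambda>k. a k n)) \<longlonglongrightarrow> (\<Sum>k. 0)"
    using dom lim_a
    by (intro conjunct2 [OF conjunct2 [OF tannerys_theorem [where M = "\<lambda>k. C * (1 / 2) ^ k"]]])
      (auto intro!: always_eventually summable_mult summable_geometric)
  moreover have "suminf (\<lambda>k. a k n) = coeff (pcompose (q n) [:h n, 1:]) i" for n
    unfolding coeff_pcompose_shift a_def
    by (subst suminf_finite [of "{..degree (q n)}"]) (auto simp: coeff_eq_0)
  ultimately show ?thesis by simp
qed

text \<open>Otherwise there would be polynomials \<open>p\<^sub>n\<close> and points \<open>x\<^sub>n\<close> such that every fixed Taylor coefficient
  of \<open>p\<^sub>n\<close> at \<open>x\<^sub>n\<close> tends to 0.  Re-expanding along a bounded number of short steps towards the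
  origin preserves this, contradicting \<open>p\<^sub>n(0) = 1\<close>.\<close>

lemma exists_large_derivative:
  fixes b B :: real
  assumes "0 \<le> b" "b < 1"
  shows "\<exists>k. \<exists>d>0. \<forall>p. coeff p 0 = 1 \<longrightarrow> (\<forall>n. \<bar>coeff p n\<bar> \<le> B) \<longrightarrow>
    (\<forall>x\<in>{0..b}. \<exists>j\<le>k. d \<le> \<bar>poly ((pderiv ^^ j) p) x\<bar>)"
proof (rule ccontr)
  assume contra: "\<not> ?thesis"
  have "\<exists>p x. coeff p 0 = 1 \<and> (\<forall>n. \<bar>coeff p n\<bar> \<le> B) \<and> x \<in> {0..b} \<and>
    (\<forall>j\<le>n. \<bar>poly ((pderiv ^^ j) p) x\<bar> < inverse (real (Suc n)))" for n
  proof -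
    have "inverse (real (Suc n)) > 0" by simp
    then show ?thesis using contra by (meson not_le)
  qed
  then obtain p x where p0: "\<And>n. coeff (p n) 0 = 1" and pB: "\<And>n k. \<bar>coeff (p n) k\<bar> \<le> B"
    and x: "\<And>n. 0 \<le> x n" "\<And>n. x n \<le> b"
    and small: "\<And>n j. j \<le> n \<Longrightarrow> \<bar>poly ((pderiv ^^ j) (p n)) (x n)\<bar> < inverse (real (Suc n))"
    unfolding atLeastAtMost_iff by metis
  define \<rho> where "\<rho> = (1 - b) / 2"
  have \<rho>: "\<rho> > 0" "b + \<rho> < 1" "b + 2 * \<rho> = 1" using assms by (auto simp: \<rho>_def field_simps)
  have B: "0 \<le> B" using pB [of 0 0] by linarith
  \<comment> \<open>The number of steps does not depend on \<open>n\<close>, and each step has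
    length at most \<open>\<rho> / 4\<close>.\<close>
  obtain m :: nat where m: "4 / \<rho> < real m" using reals_Archimedean2 by blast
  then have "m > 0" using \<rho> by (intro Nat.gr0I) (auto simp: divide_less_0_iff)
  \<comment> \<open>For fixed \<open>n\<close>, a walk from \<open>x n\<close> at
    \<open>s = 0\<close> to the origin at \<open>s = m\<close> in equal steps.\<close>
  define y where "y s n = x n * (1 - real s / real m)" for s n
  have y: "0 \<le> y s n" "y s n \<le> b" if "s \<le> m" for s n
  proof -
    have s: "0 \<le> 1 - real s / real m" "1 - real s / real m \<le> 1"
      using that \<open>m > 0\<close> by auto
    then show "0 \<le> y s n" using x by (simp add: y_def)
    show "y s n \<le> b" using mult_mono [OF x(2) s(2)] s x assms by (simp add: y_def)
  qed
  have "(\<lambda>n. coeff (pcompose (p n) [:y s n, 1:]) i) \<longlonglongrightarrow> 0" if "s \<le> m" for s i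
    using that
  proof (induction s arbitrary: i)
    case 0
    have "\<bar>coeff (pcompose (p n) [:x n, 1:]) i\<bar> \<le> inverse (real (Suc n))" if "i \<le> n" for n
    proof -
      \<comment> \<open>Taylor coefficients are derivatives divided by \<open>fact i\<close>, hence
        no larger than these.\<close>
      have "1 * \<bar>coeff (pcompose (p n) [:x n, 1:]) i\<bar>
          \<le> fact i * \<bar>coeff (pcompose (p n) [:x n, 1:]) i\<bar>"
        by (intro mult_right_mono fact_ge_1) auto
      then show ?thesis
        using small [OF that] by (simp add: poly_higher_pderiv_conv_coeff abs_mult)
    qed
    then show ?case
      by (intro Lim_null_comparison [OF _ LIMSEQ_inverse_real_of_nat] eventually_sequentiallyI [of i])
        (simp add: y_def)
  next
    case (Suc s)
    have eq: "pcompose (p n) [:y (Suc s) n, 1:] =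
        pcompose (pcompose (p n) [:y s n, 1:]) [:- (x n / real m), 1:]" for n
      by (simp add: pcompose_shift_shift y_def add_divide_distrib algebra_simps)
    show ?case
      unfolding eq
    proof (rule tendsto_coeff_pcompose_shift [where \<rho> = \<rho> and B = "B / \<rho>"])
      fix n k
      have "\<bar>coeff (pcompose (p n) [:y s n, 1:]) k\<bar> * \<rho> ^ k \<le> B / (1 - (y s n + \<rho>))"
        using y [of s n] Suc.prems \<rho> pB by (intro coeff_pcompose_shift_bound) auto
      also have "\<dots> \<le> B / \<rho>"
        using y [of s n] Suc.prems \<rho> B by (intro frac_le) auto
      finally show "\<bar>coeff (pcompose (p n) [:y s n, 1:]) k\<bar> * \<rho> ^ k \<le> B / \<rho>" .
      have "x n / real m \<le> 1 / real m"
        using x [of n] assms by (intro divide_right_mono) auto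
      also have "\<dots> \<le> \<rho> / 4" using m \<rho> \<open>m > 0\<close> by (simp add: field_simps)
      finally show "\<bar>- (x n / real m)\<bar> \<le> \<rho> / 4" using x [of n] by simp
    qed (use Suc \<rho> in auto)
  qed
  from this [of m 0] have "(\<lambda>n. 1 :: real) \<longlonglongrightarrow> 0"
    using \<open>m > 0\<close> p0 by (simp add: y_def poly_0_coeff_0)
  then show False by (simp add: LIMSEQ_const_iff)
qed

section \<open>The sublevel estimate with constants independent of the polynomial\<close>

text \<open>The interval is cut into pieces so short that a derivative of size \<open>d\<close> at
  the left endpoint of a piece keeps its sign and at least half of that size on the whole piece. The
  order of the derivative may vary with the piece.\<close>

lemma sublevel_measure_uniform:
  fixes a b B :: real
  assumes "0 \<le> a" "a < b" "b < 1" "0 \<le> B"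
  shows "\<exists>k\<ge>1. \<exists>lam>0. \<exists>M\<ge>0. \<forall>p \<epsilon>. coeff p 0 = 1 \<longrightarrow> (\<forall>n. \<bar>coeff p n\<bar> \<le> B) \<longrightarrow>
    0 < \<epsilon> \<longrightarrow> \<epsilon> < lam \<longrightarrow>
    measure lebesgue {x \<in> {a..b}. \<bar>poly p x\<bar> < \<epsilon>} \<le> M * \<epsilon> powr (1 / real k)"
proof -
  have "0 \<le> b" using assms by simp
  from exists_large_derivative [OF this \<open>b < 1\<close>, of B] obtain k d where "d > 0"
    and large: "\<And>p x. coeff p 0 = 1 \<Longrightarrow> (\<And>n. \<bar>coeff p n\<bar> \<le> B) \<Longrightarrow> x \<in> {0..b} \<Longrightarrow>
      \<exists>j\<le>k. d \<le> \<bar>poly ((pderiv ^^ j) p) x\<bar>"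
    by metis
  define lam where "lam = d / 2"
  have lam: "lam > 0" "d = 2 * lam" using \<open>d > 0\<close> by (auto simp: lam_def)
  define \<rho> where "\<rho> = (1 - b) / 2"
  have \<rho>: "\<rho> > 0" "b + \<rho> < 1" "b + 2 * \<rho> = 1" using assms by (auto simp: \<rho>_def field_simps)
  \<comment> \<open>Orders up to \<open>Suc k\<close> enter because the variation of the derivative
    of order \<open>j \<le> k\<close> is controlled by the one of order
    \<open>Suc j\<close>.\<close>
  define D where "D = (\<Sum>j\<le>Suc k. fact j * (B / \<rho> / \<rho> ^ j))"
  have D: "\<bar>poly ((pderiv ^^ j) p) x\<bar> \<le> D"
    if "\<And>n. \<bar>coeff p n\<bar> \<le> B" "0 \<le> x" "x \<le> b" "j \<le> Suc k" for p x j
  proof -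
    have "\<bar>coeff (pcompose p [:x, 1:]) j\<bar> * \<rho> ^ j \<le> B / (1 - (x + \<rho>))"
      using that \<rho> by (intro coeff_pcompose_shift_bound) auto
    also have "\<dots> \<le> B / \<rho>"
      using that \<rho> assms by (intro frac_le) auto
    finally have "\<bar>coeff (pcompose p [:x, 1:]) j\<bar> \<le> B / \<rho> / \<rho> ^ j"
      using \<rho> by (subst pos_le_divide_eq) auto
    from mult_left_mono [OF this, of "fact j"]
    have "\<bar>poly ((pderiv ^^ j) p) x\<bar> \<le> fact j * (B / \<rho> / \<rho> ^ j)"
      by (simp add: poly_higher_pderiv_conv_coeff abs_mult)
    also have "\<dots> \<le> D"
      unfolding D_def using that \<rho> assms by (intro member_le_sum) auto
    finally show ?thesis .
  qed
  have "D \<ge> 0" unfolding D_def using \<rho> assms by (intro sum_nonneg) auto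
  obtain N :: nat where N: "(b - a) * D / lam < real N" using reals_Archimedean2 by blast
  have "(b - a) * D / lam \<ge> 0" using assms \<open>D \<ge> 0\<close> lam by simp
  then have "N > 0" using N by (intro Nat.gr0I) auto
  define L where "L = (b - a) / real N"
  have L: "L > 0" "L * D \<le> lam" "b = a + real N * L"
    using assms N \<open>N > 0\<close> lam by (auto simp: L_def field_simps)
  \<comment> \<open>The last piece, \<open>S N\<close>, is just the point \<open>b\<close>; it
    serves the floor index of \<open>x = b\<close> in the covering below.\<close>
  define S where "S i = {a + real i * L..min b (a + (real i + 1) * L)}" for i :: nat
  \<comment> \<open>One positive exponent for all orders \<open>j \<le> k\<close>.\<close>
  define K where "K = Suc k"
  define M where "M = real (Suc N) * (4 * 2 ^ K) * (1 / lam) powr (1 / real K)"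
  have "measure lebesgue {x \<in> {a..b}. \<bar>poly p x\<bar> < \<epsilon>} \<le> M * \<epsilon> powr (1 / real K)"
    if p0: "coeff p 0 = 1" and pB: "\<And>n. \<bar>coeff p n\<bar> \<le> B" and \<epsilon>: "0 < \<epsilon>" "\<epsilon> < lam" for p \<epsilon>
  proof -
    \<comment> \<open>Chosen so that \<open>lam * t ^ K = \<epsilon>\<close>; as
      \<open>t \<le> 1\<close>, this is at most \<open>lam * t ^ j\<close> for each
      \<open>j \<le> k\<close>.\<close>
    define t where "t = (\<epsilon> / lam) powr (1 / real K)"
    have "K > 0" by (simp add: K_def)
    then have "t ^ K = \<epsilon> / lam"
      using \<epsilon> lam by (simp add: t_def powr_power)
    then have t: "0 < t" "t \<le> 1" "lam * t ^ K = \<epsilon>"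
      using \<epsilon> lam by (auto simp: t_def powr_le1)
    let ?E = "\<lambda>S. {x \<in> S. \<bar>poly p x\<bar> < \<epsilon>}"
    have piece: "emeasure lborel (?E (S i)) \<le> ennreal (4 * 2 ^ K * t)" if "i \<le> N" for i
    proof -
      define x0 where "x0 = a + real i * L"
      have x0: "0 \<le> x0" "x0 \<le> b"
        using that L assms by (auto simp: x0_def mult_right_mono)
      then obtain j where j: "j \<le> k" "d \<le> \<bar>poly ((pderiv ^^ j) p) x0\<bar>"
        using large [OF p0 pB, of x0] by auto
      have near: "\<bar>poly ((pderiv ^^ j) p) x - poly ((pderiv ^^ j) p) x0\<bar> \<le> lam" if "x \<in> S i" for x
      proof (cases "x0 < x")
        case True
        then obtain z where z: "x0 < z" "z < x"
          "poly ((pderiv ^^ j) p) x - poly ((pderiv ^^ j) p) x0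
            = (x - x0) * poly ((pderiv ^^ Suc j) p) z"
          by (rule poly_higher_pderiv_mvt)
        have "z \<le> b" using z that by (auto simp: S_def)
        then have "\<bar>poly ((pderiv ^^ Suc j) p) z\<bar> \<le> D"
          using x0 z j by (intro D pB) auto
        moreover have "x - x0 \<le> L"
          using that by (auto simp: S_def x0_def algebra_simps)
        ultimately have "(x - x0) * \<bar>poly ((pderiv ^^ Suc j) p) z\<bar> \<le> L * D"
          using True L by (intro mult_mono) auto
        then show ?thesis using z True L by (simp only: abs_mult)
      next
        case False
        then have "x = x0" using that by (auto simp: S_def x0_def)
        then show ?thesis using lam by simp
      qed
      have "lam * t ^ K \<le> lam * t ^ j"
        using t lam j by (intro mult_left_mono power_decreasing) (auto simp: K_def)
      then have sub: "?E (S i) \<subseteq> {x \<in> S i. \<bar>poly p x\<bar> < lam * t ^ j}"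
        using t by auto
      have neg: "(pderiv ^^ j) (-p) = - (pderiv ^^ j) p"
        using higher_pderiv_smult [of j "-1" p] by simp
      have ivl: "is_interval (S i)" by (simp add: S_def is_interval_cc)
      have "emeasure lborel {x \<in> S i. \<bar>poly p x\<bar> < lam * t ^ j} \<le> ennreal (4 * (2 ^ j - 1) * t)"
      proof (cases "poly ((pderiv ^^ j) p) x0 \<ge> 0")
        case True
        then have "lam \<le> poly ((pderiv ^^ j) p) x" if "x \<in> S i" for x
          using near [OF that] j lam by linarith
        then show ?thesis using poly_sublevel_measure ivl lam t by blast
      next
        case False
        then have "lam \<le> poly ((pderiv ^^ j) (-p)) x" if "x \<in> S i" for x
          using near [OF that] j lam neg by simp
        then show ?thesis using poly_sublevel_measure [of "S i" lam j "-p" t] ivl lam t by simp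
      qed
      also have "\<dots> \<le> ennreal (4 * 2 ^ K * t)"
      proof -
        have "(2::real) ^ j - 1 \<le> 2 ^ K - 0"
          using j by (intro diff_mono power_increasing) (auto simp: K_def)
        then have "(2::real) ^ j - 1 \<le> 2 ^ K" by (simp only: diff_zero)
        then show ?thesis
          by (intro ennreal_leI mult_right_mono mult_left_mono) (use t in simp_all)
      qed
      finally have "emeasure lborel {x \<in> S i. \<bar>poly p x\<bar> < lam * t ^ j} \<le> ennreal (4 * 2 ^ K * t)" .
      moreover have "emeasure lborel (?E (S i)) \<le> emeasure lborel {x \<in> S i. \<bar>poly p x\<bar> < lam * t ^ j}"
        using sub poly_sublevel_measurable [OF ivl] by (intro emeasure_mono) auto
      ultimately show ?thesis by (rule order_trans [rotated])
    qed
    have "{a..b} \<subseteq> (\<Union>i\<in>{..N}. S i)"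
    proof
      fix x assume x: "x \<in> {a..b}"
      define i where "i = nat \<lfloor>(x - a) / L\<rfloor>"
      have "(x - a) / L \<ge> 0" using x L by simp
      then have i: "real i \<le> (x - a) / L" "(x - a) / L < real i + 1"
        by (auto simp: i_def)
      have "(x - a) / L \<le> real N" using x L by (simp add: pos_divide_le_eq)
      then have "i \<le> N" using i by linarith
      moreover have "x \<in> S i" using i x L by (simp add: S_def pos_le_divide_eq pos_divide_less_eq)
      ultimately show "x \<in> (\<Union>i\<in>{..N}. S i)" by blast
    qed
    then have cover: "?E {a..b} \<subseteq> (\<Union>i\<in>{..N}. ?E (S i))" by blast
    have ms: "?E (S i) \<in> sets borel" for i
      by (intro poly_sublevel_measurable) (simp add: S_def is_interval_cc)
    have mE: "?E {a..b} \<in> sets borel"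
      by (intro poly_sublevel_measurable) (simp add: is_interval_cc)
    have "emeasure lborel (?E {a..b}) \<le> emeasure lborel (\<Union>i\<in>{..N}. ?E (S i))"
      using cover ms by (intro emeasure_mono) auto
    also have "\<dots> \<le> (\<Sum>i\<le>N. emeasure lborel (?E (S i)))"
      using ms by (intro emeasure_subadditive_finite) auto
    also have "\<dots> \<le> (\<Sum>i\<le>N. ennreal (4 * 2 ^ K * t))"
      by (intro sum_mono piece) auto
    also have "\<dots> = ennreal (\<Sum>i\<le>N. 4 * 2 ^ K * t)"
      using t by (intro sum_ennreal) auto
    also have "\<dots> = ennreal (real (Suc N) * (4 * 2 ^ K) * t)"
      by (simp add: algebra_simps)
    finally have "measure lborel (?E {a..b}) \<le> real (Suc N) * (4 * 2 ^ K) * t"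
      unfolding measure_def using t by (intro enn2real_leI) auto
    also have "t = (1 / lam) powr (1 / real K) * \<epsilon> powr (1 / real K)"
      using \<epsilon> lam by (simp add: t_def powr_mult [symmetric])
    finally show ?thesis
      using mE by (simp add: M_def measure_completion mult.assoc)
  qed
  moreover have "M \<ge> 0" by (simp add: M_def)
  moreover have "K \<ge> 1" by (simp add: K_def)
  ultimately show ?thesis using lam(1) by blast
qed

section \<open>Choice of \<delta> and absorption of the constant\<close>

theorem theorem4p6:
  fixes \<alpha> a b :: real
  assumes "\<alpha> > 0" and "0 \<le> a" and "a < b" and "b < 1"
  shows "\<exists>(k::nat) (\<delta>::real). k \<ge> 1 \<and> 0 < \<delta> \<and> \<delta> < 1 \<and>
    (\<forall>\<epsilon>::real. 0 < \<epsilon> \<and> \<epsilon> < \<delta> \<longrightarrow>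
      (\<forall>p \<in> (\<Union>n. F_poly \<alpha> n).
        measure lebesgue {x \<in> {a..b}. \<bar>poly p x\<bar> < \<epsilon>} \<le>
          (2 ^ (3 * k + 5) * (1 + \<alpha>) ^ (2 * k) * real (degree p) ^ (2 * (k + 1))
             / (\<delta>\<^sup>2 * (1 - r_inf \<alpha> k))) * \<epsilon> powr (1 / real k)))"
proof -
  \<comment> \<open>The bound \<open>1 + \<alpha>\<close> covers the constant coefficient 1 together
    with the others.\<close>
  have "0 \<le> 1 + \<alpha>" using assms by simp
  with sublevel_measure_uniform [of a b "1 + \<alpha>"] assms
  obtain k lam M where k: "k \<ge> 1" and lam: "lam > 0" and M: "M \<ge> 0"
    and main: "\<And>p \<epsilon>. coeff p 0 = 1 \<Longrightarrow> (\<And>n. \<bar>coeff p n\<bar> \<le> 1 + \<alpha>) \<Longrightarrow> 0 < \<epsilon> \<Longrightarrow> \<epsilon> < lam \<Longrightarrow>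
      measure lebesgue {x \<in> {a..b}. \<bar>poly p x\<bar> < \<epsilon>} \<le> M * \<epsilon> powr (1 / real k)"
    by blast
  \<comment> \<open>The three bounds give, in order, the range of \<epsilon> in \<open>main\<close>,
    \<open>\<delta> < 1\<close>, and \<open>M * \<delta> \<le> 1\<close>.\<close>
  define \<delta> where "\<delta> = min lam (min (1 / 2) (1 / (1 + M)))"
  have \<delta>: "0 < \<delta>" "\<delta> < 1" "\<delta> \<le> lam" "\<delta> \<le> 1 / (1 + M)"
    using lam M by (auto simp: \<delta>_def)
  let ?C = "\<lambda>p. 2 ^ (3 * k + 5) * (1 + \<alpha>) ^ (2 * k) * real (degree p) ^ (2 * (k + 1))
    / (\<delta>\<^sup>2 * (1 - r_inf \<alpha> k))"
  have "measure lebesgue {x \<in> {a..b}. \<bar>poly p x\<bar> < \<epsilon>} \<le> ?C p * \<epsilon> powr (1 / real k)"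
    if \<epsilon>: "0 < \<epsilon>" "\<epsilon> < \<delta>" and p: "p \<in> F_poly \<alpha> n" for \<epsilon> p n
  \<comment> \<open>In degree 0 the constant \<open>?C p\<close> vanishes, but then \<open>p\<close>
    is 1 and the sublevel set is empty because \<open>\<epsilon> < 1\<close>.\<close>
  proof (cases "degree p = 0")
    case True
    have p0: "coeff p 0 = 1" using p by (simp add: F_poly_def F_series_def)
    from True obtain c where "p = [:c:]" by (rule degree_eq_zeroE)
    with p0 have "p = [:1:]" by simp
    then have "{x \<in> {a..b}. \<bar>poly p x\<bar> < \<epsilon>} = {}" using \<epsilon> \<delta> by auto
    then show ?thesis by (simp only: measure_empty) (simp add: True)
  next
    case False
    have p0: "coeff p 0 = 1" and pn: "\<And>n. n \<ge> 1 \<Longrightarrow> \<bar>coeff p n\<bar> \<le> \<alpha>"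
      using p by (auto simp: F_poly_def F_series_def abs_le_iff minus_le_iff)
    have "\<bar>coeff p n\<bar> \<le> 1 + \<alpha>" for n
      using p0 pn [of n] assms by (cases "n = 0") auto
    then have "measure lebesgue {x \<in> {a..b}. \<bar>poly p x\<bar> < \<epsilon>} \<le> M * \<epsilon> powr (1 / real k)"
      using p0 \<epsilon> \<delta> by (intro main) auto
    also have "M \<le> ?C p"
    proof -
      have r: "0 \<le> r_inf \<alpha> k" "r_inf \<alpha> k < 1"
        using r_inf_bounds assms by auto
      \<comment> \<open>A single factor \<delta> suffices to cancel \<open>M\<close>; the rest of
        the denominator is at most 1, and the numerator is at least 1.\<close>
      have "\<delta>\<^sup>2 * (1 - r_inf \<alpha> k) \<le> \<delta> * 1"
        using \<delta> r by (intro mult_mono) (auto simp: power2_eq_square mult_left_le)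
      then have "M * (\<delta>\<^sup>2 * (1 - r_inf \<alpha> k)) \<le> M * (1 / (1 + M))"
        using \<delta> M by (intro mult_left_mono) auto
      also have "\<dots> \<le> 1 * 1 * 1" using M by (simp add: field_simps)
      also have "\<dots> \<le> 2 ^ (3 * k + 5) * (1 + \<alpha>) ^ (2 * k) * real (degree p) ^ (2 * (k + 1))"
        using False assms by (intro mult_mono one_le_power) auto
      finally show ?thesis using \<delta> r by (simp add: pos_le_divide_eq)
    qed
    finally show ?thesis by (simp add: mult_right_mono)
  qed
  then show ?thesis using k \<delta> by blast
qed

end
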